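(* Let $m,n$ be positive integers, $A=\{(i,j)\in\mathbb{Z}^2: 0\le i<m,\ 0\le j<n\}$, let $S$ be a valid set of directions for $A$, and suppose prescribed line sums along all lines with directions in $S$ are given which are the line sums of some function $A\to\mathbb{R}$. Let $f_0$ be the projection function for these line sums, let $D$ be the sum of the prescribed line sums in any one direction of $S$, let $\langle x\rangle=\min(|x|,|1-x|)$ and $E=\sum_{(i,j)\in A}\langle f_0(i,j)\rangle^2$. Let $F:A\to\{0,1\}$ be obtained by rounding each $f_0(i,j)$ to an element of $\{0,1\}$ nearest to it. Let $b_1\le b_2\le\dots\le b_{mn}$ be the values $|2f_0(i,j)-1|$, $(i,j)\in A$, in nondecreasing order. Let $s$ be the integer with $b_1+\dots+b_s\le D-E-|\vec{f_0}|^2<b_1+\dots+b_{s+1}$, and $t$ the integer with $b_1+\dots+b_t\le 2(D-E-|\vec{f_0}|^2)<b_1+\dots+b_{t+1}$. Then: (a) every function $g:A\to\{0,1\}$ with the prescribed line sums satisfies $g(i,j)=F(i,j)$ for at least $mn-s$ elements $(i,j)\in A$; (b) any two functions $g_1,g_2:A\to\{0,1\}$ with the prescribed line sums satisfy $g_1(i,j)=g_2(i,j)$ for at least $mn-t$ elements $(i,j)\in A$.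
   Context: A direction is a pair $(a,b)\in\mathbb{Z}^2$ with $\gcd(a,b)=1$ and $a\ge 0$, where $(a,b)=(0,1)$ if $a=0$. The lines with direction $(a,b)$ are the lines $ay=bx+t$ ($t\in\mathbb{Z}$); the line sum of $g:A\to\mathbb{R}$ along $ay=bx+t$ is $\sum g(i,j)$ over all $(i,j)\in A$ with $aj=bi+t$. A finite set $S=\{(a_d,b_d)\}_{d=1}^k$ of distinct directions is valid for $A$ if $\sum_d a_d<m$ and $\sum_d |b_d|<n$. Functions $A\to\mathbb{R}$ are identified with vectors in $\mathbb{R}^{mn}$ with Euclidean norm $|\vec v|=\sqrt{\sum_{(i,j)\in A}v(i,j)^2}$. The projection function $f_0$ for the given line sums is the unique function $A\to\mathbb{R}$ having these line sums whose vector is orthogonal to the vector of every function $A\to\mathbb{R}$ with all line sums (in the directions of $S$) equal to $0$. Empty sums are $0$. *)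

theory Defs
  imports Complex_Main "HOL-Library.FuncSet" "HOL-Library.Multiset"
begin

definition grid :: "nat \<Rightarrow> nat \<Rightarrow> (int \<times> int) set" where
  "grid m n = {0..<int m} \<times> {0..<int n}"

definition is_direction :: "int \<times> int \<Rightarrow> bool" where
  "is_direction d \<longleftrightarrow> (case d of (a, b) \<Rightarrow> gcd a b = 1 \<and> a \<ge> 0 \<and> (a = 0 \<longrightarrow> b = 1))"

definition valid_directions :: "nat \<Rightarrow> nat \<Rightarrow> (int \<times> int) set \<Rightarrow> bool" where
  "valid_directions m n S \<longleftrightarrow> finite S \<and> (\<forall>d\<in>S. is_direction d)
     \<and> (\<Sum>(a, b)\<in>S. a) < int m \<and> (\<Sum>(a, b)\<in>S. \<bar>b\<bar>) < int n"

text \<open>A function on a set A of lattice points is represented by a total function on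
  pairs of integers; only its values on A matter.\<close>

definition line_points :: "(int \<times> int) set \<Rightarrow> int \<times> int \<Rightarrow> int \<Rightarrow> (int \<times> int) set" where
  "line_points A d t = (case d of (a, b) \<Rightarrow> {(i, j). (i, j) \<in> A \<and> a * j = b * i + t})"

definition line_sum :: "(int \<times> int) set \<Rightarrow> (int \<times> int \<Rightarrow> real) \<Rightarrow> int \<times> int \<Rightarrow> int \<Rightarrow> real" where
  "line_sum A g d t = (\<Sum>q\<in>line_points A d t. g q)"

definition has_line_sums ::
  "(int \<times> int) set \<Rightarrow> (int \<times> int) set \<Rightarrow> (int \<times> int \<Rightarrow> int \<Rightarrow> real) \<Rightarrow> (int \<times> int \<Rightarrow> real) \<Rightarrow> bool" where
  "has_line_sums A S p g \<longleftrightarrow> (\<forall>d\<in>S. \<forall>t. line_sum A g d t = p d t)"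

text \<open>The sum of the prescribed line sums in direction d. Only finitely many lines meet a
  finite A; line sums along all other lines are empty sums and hence 0.\<close>

definition total_line_sum ::
  "(int \<times> int) set \<Rightarrow> (int \<times> int \<Rightarrow> int \<Rightarrow> real) \<Rightarrow> int \<times> int \<Rightarrow> real" where
  "total_line_sum A p d = (\<Sum>t | line_points A d t \<noteq> {}. p d t)"

definition inner_on :: "'a set \<Rightarrow> ('a \<Rightarrow> real) \<Rightarrow> ('a \<Rightarrow> real) \<Rightarrow> real" where
  "inner_on A u v = (\<Sum>q\<in>A. u q * v q)"

definition norm_on :: "'a set \<Rightarrow> ('a \<Rightarrow> real) \<Rightarrow> real" where
  "norm_on A v = sqrt (\<Sum>q\<in>A. (v q)\<^sup>2)"

definition is_projection_function ::
  "(int \<times> int) set \<Rightarrow> (int \<times> int) set \<Rightarrow> (int \<times> int \<Rightarrow> int \<Rightarrow> real) \<Rightarrow> (int \<times> int \<Rightarrow> real) \<Rightarrow> bool" where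
  "is_projection_function A S p f \<longleftrightarrow> has_line_sums A S p f
     \<and> (\<forall>g. has_line_sums A S (\<lambda>_ _. 0) g \<longrightarrow> inner_on A f g = 0)"

text \<open>The restriction to extensional functions on A makes the projection function unique as a
  total function; see the lemma \<open>ex1_projection_function\<close> below.\<close>

definition projection_function ::
  "(int \<times> int) set \<Rightarrow> (int \<times> int) set \<Rightarrow> (int \<times> int \<Rightarrow> int \<Rightarrow> real) \<Rightarrow> int \<times> int \<Rightarrow> real" where
  "projection_function A S p = (THE f. f \<in> extensional A \<and> is_projection_function A S p f)"

definition dist01 :: "real \<Rightarrow> real" where
  "dist01 x = min \<bar>x\<bar> \<bar>1 - x\<bar>"

text \<open>No choice is made at ties: for x = 1/2 both 0 and 1 are nearest.\<close>

definition is_rounding01 :: "real \<Rightarrow> real \<Rightarrow> bool" where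
  "is_rounding01 x c \<longleftrightarrow> c \<in> {0, 1} \<and> (\<forall>c'\<in>{0, 1}. \<bar>x - c\<bar> \<le> \<bar>x - c'\<bar>)"

lemma inner_on_add_scale:
  "inner_on A (\<lambda>q. u q + c * x q) w = inner_on A u w + c * inner_on A x w"
  "inner_on A w (\<lambda>q. u q + c * x q) = inner_on A w u + c * inner_on A w x"
  "inner_on A (\<lambda>q. u q - x q) w = inner_on A u w - inner_on A x w"
  "inner_on A w (\<lambda>q. u q - x q) = inner_on A w u - inner_on A w x"
  by (simp_all add: inner_on_def algebra_simps sum.distrib sum_distrib_left sum_subtractf)

lemma inner_on_self_zero:
  assumes "finite A" "inner_on A u u = 0" "q \<in> A"
  shows "u q = 0"
  using assms by (simp add: inner_on_def sum_nonneg_eq_0_iff)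

lemma orthogonal_decomposition:
  fixes V :: "('a \<Rightarrow> real) set"
  assumes "finite A" "finite V"
  shows "\<exists>u. (\<forall>w. (\<forall>v\<in>V. inner_on A v w = 0) \<longrightarrow> inner_on A u w = 0)
           \<and> (\<forall>v\<in>V. inner_on A v (\<lambda>q. h q - u q) = 0)"
  using assms(2)
proof (induction V arbitrary: h rule: finite_induct)
  case empty
  show ?case by (rule exI[of _ "\<lambda>_. 0"]) (simp add: inner_on_def)
next
  case (insert x V)
  obtain y where y: "\<And>w. (\<forall>v\<in>V. inner_on A v w = 0) \<Longrightarrow> inner_on A y w = 0"
      "\<And>v. v \<in> V \<Longrightarrow> inner_on A v (\<lambda>q. x q - y q) = 0"
    using insert.IH[of x] by blast
  obtain u where u: "\<And>w. (\<forall>v\<in>V. inner_on A v w = 0) \<Longrightarrow> inner_on A u w = 0"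
      "\<And>v. v \<in> V \<Longrightarrow> inner_on A v (\<lambda>q. h q - u q) = 0"
    using insert.IH[of h] by blast
  define z where "z = (\<lambda>q. x q - y q)"
  define r where "r = (\<lambda>q. h q - u q)"
  define c where "c = inner_on A z r / inner_on A z z"
  have c: "c * inner_on A z z = inner_on A z r"
  proof (cases "inner_on A z z = 0")
    case True
    then have "inner_on A z r = 0"
      using inner_on_self_zero[OF assms(1) True] by (simp add: inner_on_def)
    with True show ?thesis by simp
  qed (simp add: c_def)
  have zw: "inner_on A z w = inner_on A x w - inner_on A y w" for w
    by (simp add: z_def inner_on_add_scale)
  define u' where "u' = (\<lambda>q. u q + c * z q)"
  have hu': "inner_on A w (\<lambda>q. h q - u' q) = inner_on A w r - c * inner_on A w z" for w
    by (simp add: u'_def r_def inner_on_add_scale)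
  have V: "inner_on A v (\<lambda>q. h q - u' q) = 0" if "v \<in> V" for v
    using y(2)[OF that] u(2)[OF that] by (simp add: hu' flip: z_def r_def)
  have "inner_on A y (\<lambda>q. h q - u' q) = 0" using y(1) V by blast
  moreover have "inner_on A z (\<lambda>q. h q - u' q) = 0" by (simp add: hu' c)
  ultimately have "inner_on A x (\<lambda>q. h q - u' q) = 0" by (simp add: zw)
  moreover have "inner_on A u' w = 0" if "\<forall>v\<in>insert x V. inner_on A v w = 0" for w
    using that y(1)[of w] u(1)[of w] by (simp add: u'_def inner_on_add_scale zw)
  ultimately show ?case using V by (intro exI[of _ u']) auto
qed

lemma ex1_projection_function:
  assumes A: "finite A" and S: "finite S" and h: "has_line_sums A S p h"
  shows "\<exists>!f. f \<in> extensional A \<and> is_projection_function A S p f"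
proof -
  define ind where
    "ind = (\<lambda>(d, t) q. if q \<in> line_points A d t then 1 else 0 :: real)"
  define V where "V = ind ` (SIGMA d:S. {t. line_points A d t \<noteq> {}})"
  have sub: "line_points A d t \<subseteq> A" for d t
    by (auto simp: line_points_def split: prod.splits)
  have "{t. line_points A d t \<noteq> {}} \<subseteq> (\<lambda>(i, j). fst d * j - snd d * i) ` A" for d
  proof
    fix t assume "t \<in> {t. line_points A d t \<noteq> {}}"
    then obtain i j where "(i, j) \<in> A" "fst d * j = snd d * i + t"
      by (auto simp: line_points_def split: prod.splits)
    then show "t \<in> (\<lambda>(i, j). fst d * j - snd d * i) ` A"
      by (intro image_eqI[of _ _ "(i, j)"]) simp_all
  qed
  then have "finite {t. line_points A d t \<noteq> {}}" for d
    by (rule finite_subset[OF _ finite_imageI[OF A]])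
  then have finV: "finite V" unfolding V_def using S by (intro finite_imageI finite_SigmaI) auto
  have ls: "line_sum A g d t = inner_on A (ind (d, t)) g" for g d t
  proof -
    have "inner_on A (ind (d, t)) g = (\<Sum>q\<in>A. if q \<in> line_points A d t then g q else 0)"
      unfolding inner_on_def ind_def by (intro sum.cong) simp_all
    also have "\<dots> = line_sum A g d t"
      unfolding line_sum_def sum.inter_restrict[OF A, symmetric] Int_absorb1[OF sub] ..
    finally show ?thesis by simp
  qed
  have zero: "has_line_sums A S (\<lambda>_ _. 0) g \<longleftrightarrow> (\<forall>v\<in>V. inner_on A v g = 0)" for g
  proof -
    have "(\<forall>v\<in>V. inner_on A v g = 0)
        \<longleftrightarrow> (\<forall>d\<in>S. \<forall>t. line_points A d t \<noteq> {} \<longrightarrow> line_sum A g d t = 0)"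
      unfolding V_def ls by blast
    moreover have "line_points A d t = {} \<Longrightarrow> line_sum A g d t = 0" for d t
      by (simp add: line_sum_def)
    ultimately show ?thesis unfolding has_line_sums_def by blast
  qed
  have diff: "has_line_sums A S (\<lambda>d t. p1 d t - p2 d t) (\<lambda>q. f q - g q)"
    if "has_line_sums A S p1 f" "has_line_sums A S p2 g" for p1 p2 f g
    using that by (simp add: has_line_sums_def line_sum_def sum_subtractf)
  have cong_ls: "has_line_sums A S p' f \<longleftrightarrow> has_line_sums A S p' g"
    if "\<And>q. q \<in> A \<Longrightarrow> f q = g q" for p' f g
  proof -
    have "line_sum A f d t = line_sum A g d t" for d t
      unfolding line_sum_def using that subsetD[OF sub] by (intro sum.cong) blast+
    then show ?thesis by (simp add: has_line_sums_def)
  qed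
  obtain u where u: "\<And>w. (\<forall>v\<in>V. inner_on A v w = 0) \<Longrightarrow> inner_on A u w = 0"
      "\<forall>v\<in>V. inner_on A v (\<lambda>q. h q - u q) = 0"
    using orthogonal_decomposition[OF A finV, of h] by blast
  have "has_line_sums A S (\<lambda>_ _. 0) (\<lambda>q. h q - u q)" using u(2) zero by blast
  from diff[OF h this] have "has_line_sums A S p u" by simp
  then have "has_line_sums A S p (restrict u A)"
    using cong_ls[of "restrict u A" u] by simp
  moreover have "inner_on A (restrict u A) g = inner_on A u g" for g
    by (auto simp: inner_on_def intro!: sum.cong)
  ultimately have ex: "restrict u A \<in> extensional A \<and> is_projection_function A S p (restrict u A)"
    using u(1) zero by (simp add: is_projection_function_def)
  show ?thesis
  proof (rule ex_ex1I)
    show "\<exists>f. f \<in> extensional A \<and> is_projection_function A S p f" using ex by blast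
  next
    fix f g
    assume f: "f \<in> extensional A \<and> is_projection_function A S p f"
      and g: "g \<in> extensional A \<and> is_projection_function A S p g"
    have "has_line_sums A S (\<lambda>_ _. 0) (\<lambda>q. f q - g q)"
      using diff[of p f p g] f g by (simp add: is_projection_function_def)
    then have "inner_on A (\<lambda>q. f q - g q) (\<lambda>q. f q - g q) = 0"
      using f g by (simp add: is_projection_function_def inner_on_add_scale(3))
    from inner_on_self_zero[OF A this] have "\<And>q. q \<in> A \<Longrightarrow> f q = g q" by simp
    then show "f = g" using f g by (blast intro: extensionalityI)
  qed
qed

end

theory Submission
  imports Defs
begin

text \<open>A binary solution \<open>g\<close> has squared norm \<open>D\<close>, and \<open>g - f0\<close> is orthogonal to \<open>f0\<close>, so
  \<open>|g - f0|\<^sup>2 = D - |f0|\<^sup>2\<close> by Pythagoras. Replacing \<open>F\<close> by \<open>g\<close> increases the squared distance to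
  \<open>f0\<close>, which is \<open>E\<close> for \<open>F\<close>, by exactly \<open>|2 f0(i,j) - 1|\<close> at each point where they differ. Hence
  these weights, summed over the disagreement set of \<open>g\<close> and \<open>F\<close>, give \<open>D - E - |f0|\<^sup>2\<close>, which bounds
  the size of that set. Two binary solutions differ only where one of them differs from \<open>F\<close>.\<close>

text \<open>Among submultisets of a given size, the initial segment of the sorted list has the least
  sum. Induction on the list: one element of \<open>M\<close> is matched with the head, the rest
  with the tail.\<close>

lemma sum_list_take_le_sum_mset:
  fixes xs :: "'a::{linorder, ordered_comm_monoid_add} list"
  assumes "sorted xs" "M \<subseteq># mset xs"
  shows "sum_list (take (size M) xs) \<le> sum_mset M"
  using assms
proof (induction xs arbitrary: M)
  case Nil
  then show ?case by simp
next
  case (Cons x xs)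
  show ?case
  proof (cases "M = {#}")
    case False
    \<comment> \<open>The element to match with the head is \<open>x\<close> itself if
      \<open>M\<close> contains it, otherwise any element of \<open>M\<close>; either way
      \<open>x \<le> y\<close>.\<close>
    then obtain y where y: "y \<in># M" "x \<in># M \<Longrightarrow> y = x"
      by (metis multiset_nonemptyE)
    then obtain N where M: "M = add_mset y N"
      by (meson multi_member_split)
    have "y \<in># mset (x # xs)"
      using y(1) Cons.prems(2) by (rule mset_subset_eqD[rotated])
    then have "x \<le> y"
      using Cons.prems(1) by auto
    have "N \<subseteq># mset xs"
    proof (cases "x \<in># M")
      case True
      then show ?thesis using Cons.prems(2) by (simp add: M y(2)[OF True])
    next
      case False
      \<comment> \<open>Here \<open>M\<close> avoids one copy of the head for free, so it fits into
        the tail even before \<open>y\<close> is removed.\<close>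
      then have "M \<subseteq># mset xs"
        using Cons.prems(2) subset_eq_diff_conv[of M "{#x#}" "mset xs"] by (simp add: diff_single_trivial)
      then show ?thesis
        unfolding M by (rule subset_mset.order_trans[rotated]) simp
    qed
    then have "sum_list (take (size N) xs) \<le> sum_mset N"
      using Cons by simp
    with \<open>x \<le> y\<close> show ?thesis
      by (simp add: M add_mono)
  qed simp
qed

text \<open>Otherwise \<open>s + 1\<close> elements of \<open>B\<close> alone would weigh at least
  as much as the \<open>s + 1\<close> smallest weights on \<open>A\<close>.\<close>

lemma card_le_if_sum_less_sum_list_take:
  fixes w :: "'a \<Rightarrow> 'b::{linorder, ordered_comm_monoid_add}"
  assumes "finite A" "B \<subseteq> A" "\<And>q. q \<in> A \<Longrightarrow> 0 \<le> w q"
    and "mset xs = image_mset w (mset_set A)" "sorted xs"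
    and "sum w B < sum_list (take (s + 1) xs)"
  shows "card B \<le> s"
proof (rule ccontr)
  assume "\<not> card B \<le> s"
  then obtain C where C: "C \<subseteq> B" "card C = s + 1" "finite C"
    using obtain_subset_with_card_n[of "s + 1" B] by auto
  have "image_mset w (mset_set C) \<subseteq># mset xs"
    unfolding assms(4) using C assms(1,2)
    by (intro image_mset_subseteq_mono subset_imp_msubset_mset_set) auto
  from sum_list_take_le_sum_mset[OF assms(5) this]
  have "sum_list (take (s + 1) xs) \<le> sum w C"
    using C by (simp add: sum_unfold_sum_mset)
  also have "\<dots> \<le> sum w B"
    using C assms(1-3) by (intro sum_mono2) (auto intro: finite_subset)
  finally show False
    using assms(6) by simp
qed

lemma total_line_sum_eq_sum:
  assumes "finite A" "has_line_sums A S p g" "d \<in> S"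
  shows "total_line_sum A p d = sum g A"
proof -
  \<comment> \<open>\<open>c q\<close> is the parameter \<open>t\<close> of the line in direction
    \<open>d\<close> through \<open>q\<close>, so the lines are the fibres of \<open>c\<close> and
    partition \<open>A\<close>.\<close>
  define c where "c = (\<lambda>(i, j). fst d * j - snd d * i)"
  have pts: "line_points A d t = {q \<in> A. c q = t}" for t
    by (auto simp: line_points_def c_def split: prod.splits)
  then have "{t. line_points A d t \<noteq> {}} = c ` A"
    by auto
  then have "total_line_sum A p d = (\<Sum>t\<in>c ` A. sum g {q \<in> A. c q = t})"
    using assms(2,3)
    by (simp add: total_line_sum_def has_line_sums_def line_sum_def flip: pts)
  also have "\<dots> = sum g A"
    using assms(1) by (intro sum.group) auto
  finally show ?thesis .
qed

lemma is_projection_function_projection_function: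
  assumes "finite A" "finite S" "has_line_sums A S p h"
  shows "is_projection_function A S p (projection_function A S p)"
  using theI'[OF ex1_projection_function[OF assms]] by (simp add: projection_function_def)

lemma norm_on_power2: "(norm_on A v)\<^sup>2 = inner_on A v v"
  by (simp add: norm_on_def inner_on_def sum_nonneg power2_eq_square)

text \<open>The difference \<open>g - f\<close> has zero line sums and is therefore orthogonal to
  \<open>f\<close>.\<close>

lemma projection_function_pythagoras:
  assumes "is_projection_function A S p f" "has_line_sums A S p g"
  shows "(\<Sum>q\<in>A. (g q - f q)\<^sup>2) = inner_on A g g - inner_on A f f"
proof -
  have "has_line_sums A S (\<lambda>_ _. 0) (\<lambda>q. g q - f q)"
    using assms by (simp add: is_projection_function_def has_line_sums_def line_sum_def sum_subtractf)
  then have "inner_on A f (\<lambda>q. g q - f q) = 0"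
    using assms(1) by (simp add: is_projection_function_def)
  then have "inner_on A f g = inner_on A f f"
    by (simp add: inner_on_add_scale(4))
  moreover have "(\<Sum>q\<in>A. (g q - f q)\<^sup>2) = inner_on A g g - 2 * inner_on A f g + inner_on A f f"
    by (simp add: inner_on_def power2_diff sum.distrib sum_subtractf sum_distrib_left algebra_simps
        power2_eq_square)
  ultimately show ?thesis by simp
qed

text \<open>The squared distances from \<open>x\<close> to 1 and to 0 differ by
  \<open>1 - 2 * x\<close>, whose sign is decided by which of them is nearest. At
  \<open>x = 1/2\<close> the extra term vanishes, so the choice made at a tie is immaterial.\<close>

lemma power2_diff_eq_dist01_rounding:
  assumes "is_rounding01 x c" "e \<in> {0, 1}"
  shows "(e - x)\<^sup>2 = (dist01 x)\<^sup>2 + (if e = c then 0 else \<bar>2 * x - 1\<bar>)"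
proof -
  have "c = 0 \<and> x \<le> 1/2 \<or> c = 1 \<and> x \<ge> 1/2"
    using assms(1) by (auto simp: is_rounding01_def abs_if split: if_splits)
  moreover from this have "dist01 x = \<bar>x - c\<bar>"
    by (auto simp: dist01_def)
  ultimately show ?thesis
    using assms(2) by (auto simp: power2_eq_square algebra_simps)
qed

lemma sum_weights_disagreement:
  fixes f F g :: "int \<times> int \<Rightarrow> real"
  assumes "finite A" "is_projection_function A S p f" "d \<in> S"
    and "\<forall>q\<in>A. is_rounding01 (f q) (F q)"
    and "g \<in> A \<rightarrow> {0, 1}" "has_line_sums A S p g"
  shows "(\<Sum>q | q \<in> A \<and> g q \<noteq> F q. \<bar>2 * f q - 1\<bar>)
    = total_line_sum A p d - (\<Sum>q\<in>A. (dist01 (f q))\<^sup>2) - (norm_on A f)\<^sup>2"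
proof -
  \<comment> \<open>Values in \<open>{0, 1}\<close> equal their squares, so the squared norm of
    \<open>g\<close> is its plain sum over \<open>A\<close>.\<close>
  have "inner_on A g g = total_line_sum A p d"
    unfolding total_line_sum_eq_sum[OF assms(1,6,3)] inner_on_def
    using assms(5) by (intro sum.cong) fastforce+
  moreover have "(\<Sum>q\<in>A. (g q - f q)\<^sup>2)
      = (\<Sum>q\<in>A. (dist01 (f q))\<^sup>2 + (if g q \<noteq> F q then \<bar>2 * f q - 1\<bar> else 0))"
    using assms(4,5)
    by (intro sum.cong refl) (subst power2_diff_eq_dist01_rounding, auto)
  moreover have "\<dots> = (\<Sum>q\<in>A. (dist01 (f q))\<^sup>2) + (\<Sum>q | q \<in> A \<and> g q \<noteq> F q. \<bar>2 * f q - 1\<bar>)"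
    using assms(1) by (simp add: sum.distrib sum.inter_filter)
  ultimately show ?thesis
    using projection_function_pythagoras[OF assms(2,6)] by (simp add: norm_on_power2)
qed

lemma card_filter_not:
  assumes "finite A"
  shows "card {q \<in> A. P q} = card A - card {q \<in> A. \<not> P q}"
proof -
  have "{q \<in> A. P q} = A - {q \<in> A. \<not> P q}" by auto
  then show ?thesis using assms by (simp add: card_Diff_subset)
qed

theorem theorem4p2:
  fixes m n :: nat
    and A S :: "(int \<times> int) set"
    and p :: "int \<times> int \<Rightarrow> int \<Rightarrow> real"
    and f0 F :: "int \<times> int \<Rightarrow> real"
    and d :: "int \<times> int"
    and D E X :: real
    and bs :: "real list"
  assumes "m > 0" and "n > 0"
    and "A = grid m n"
    and "valid_directions m n S"
    and "\<exists>h. has_line_sums A S p h"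
    and "f0 = projection_function A S p"
    and "d \<in> S"
    and "D = total_line_sum A p d"
    and "E = (\<Sum>q\<in>A. (dist01 (f0 q))\<^sup>2)"
    and "\<forall>q\<in>A. is_rounding01 (f0 q) (F q)"
    and "mset bs = image_mset (\<lambda>q. \<bar>2 * f0 q - 1\<bar>) (mset_set A)"
    and "sorted bs"
    and "X = D - E - (norm_on A f0)\<^sup>2"
  shows "(\<forall>s < m * n. sum_list (take s bs) \<le> X \<and> X < sum_list (take (s + 1) bs) \<longrightarrow>
           (\<forall>g \<in> A \<rightarrow> {0, 1}. has_line_sums A S p g \<longrightarrow>
              card {q \<in> A. g q = F q} \<ge> m * n - s))
    \<and> (\<forall>t < m * n. sum_list (take t bs) \<le> 2 * X \<and> 2 * X < sum_list (take (t + 1) bs) \<longrightarrow>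
           (\<forall>g1 \<in> A \<rightarrow> {0, 1}. \<forall>g2 \<in> A \<rightarrow> {0, 1}.
              has_line_sums A S p g1 \<longrightarrow> has_line_sums A S p g2 \<longrightarrow>
              card {q \<in> A. g1 q = g2 q} \<ge> m * n - t))"
proof -
  define w where "w = (\<lambda>q. \<bar>2 * f0 q - 1\<bar>)"
  have w0: "0 \<le> w q" for q
    by (simp add: w_def)
  have A: "finite A" "card A = m * n"
    using assms(3) by (simp_all add: grid_def)
  have f0: "is_projection_function A S p f0"
    using assms(4-6) A is_projection_function_projection_function
    by (auto simp: valid_directions_def)
  have X: "sum w {q \<in> A. g q \<noteq> F q} = X" if "g \<in> A \<rightarrow> {0, 1}" "has_line_sums A S p g" for g
    using sum_weights_disagreement[OF A(1) f0 assms(7,10) that] assms(8,9,13) by (simp add: w_def)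
  have few: "card B \<le> s" if "B \<subseteq> A" "sum w B < sum_list (take (s + 1) bs)" for B s
    using card_le_if_sum_less_sum_list_take[OF A(1) that(1) _ _ assms(12) that(2)] assms(11) w0
    by (simp add: w_def)
  have a: "card {q \<in> A. g q = F q} \<ge> m * n - s"
    if "X < sum_list (take (s + 1) bs)" "g \<in> A \<rightarrow> {0, 1}" "has_line_sums A S p g" for s g
    using few[of "{q \<in> A. g q \<noteq> F q}" s] X[OF that(2,3)] that(1) A(2)
    by (subst card_filter_not[OF A(1)]) simp
  have b: "card {q \<in> A. g1 q = g2 q} \<ge> m * n - t"
    if "2 * X < sum_list (take (t + 1) bs)" "g1 \<in> A \<rightarrow> {0, 1}" "g2 \<in> A \<rightarrow> {0, 1}"
      "has_line_sums A S p g1" "has_line_sums A S p g2" for t g1 g2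
  proof -
    let ?B1 = "{q \<in> A. g1 q \<noteq> F q}" and ?B2 = "{q \<in> A. g2 q \<noteq> F q}"
    have "sum w {q \<in> A. g1 q \<noteq> g2 q} \<le> sum w (?B1 \<union> ?B2)"
      using A by (intro sum_mono2) (auto simp: w0)
    \<comment> \<open>Points of \<open>?B1 \<inter> ?B2\<close> count twice on the right, which is
      harmless for nonnegative weights.\<close>
    also have "\<dots> \<le> sum w ?B1 + sum w ?B2"
      using A sum.union_inter[of ?B1 ?B2 w] sum_nonneg[of "?B1 \<inter> ?B2" w] w0 by simp
    \<comment> \<open>Each binary solution has disagreement weight exactly \<open>X\<close> with
      \<open>F\<close>; this is where the factor 2 arises.\<close>
    also have "\<dots> = 2 * X"
      using X that by simp
    finally show ?thesis
      using few[of "{q \<in> A. g1 q \<noteq> g2 q}" t] that(1) A(2)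
      by (subst card_filter_not[OF A(1)]) simp
  qed
  show ?thesis
    using a b by blast
qed

end
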